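(* Let $\mathcal{P}$ be a finite collection of cells of $\mathbb{N}^2$, let $S$ be the polynomial ring associated to $\mathcal{P}$, and let $\Lambda$ be the lattice associated to $\mathcal{P}$. Then there exists a monomial $u\in S$ such that $$I_\Lambda=(I_{\mathcal{P}}:u).$$
   Context: For $a=(i,j),b=(k,\ell)\in\mathbb{N}^2$ with $i\le k$, $j\le \ell$, the interval $[a,b]$ is $\{(r,s)\in\mathbb{N}^2: i\le r\le k,\ j\le s\le \ell\}$; it is proper if $i<k$ and $j<\ell$, and then its anti-diagonal corners are $c=(i,\ell)$ and $d=(k,j)$. A cell is an interval $C=[a,a+(1,1)]$ (with lower left corner $a$), and $V(C)$ is the set of its four corners. For a finite collection $\mathcal{P}$ of cells, with $\mathcal{P}\subseteq[(1,1),(m,n)]$, put $V(\mathcal{P})=\bigcup_{C\in\mathcal{P}}V(C)$. A proper interval $[a,b]$ is an inner interval of $\mathcal{P}$ if all cells contained in it belong to $\mathcal{P}$. Let $\mathbb{K}$ be a field and $S=\mathbb{K}[x_v\mid v\in V(\mathcal{P})]$ (the polynomial ring associated to $\mathcal{P}$). $I_{\mathcal{P}}\subset S$ is the ideal generated by all binomials $x_ax_b-x_cx_d$, where $[a,b]$ is an inner interval of $\mathcal{P}$ with anti-diagonal corners $c,d$. Let $\{\mathbf{e}_{ij}\}$ be the canonical basis of $\mathbb{Z}^{m\times n}$, and let $C_1,\dots,C_r$ be the cells of $\mathcal{P}$. For the cell $C_k$ with lower left corner $(i,j)$ put $\mathbf{c}_k=\mathbf{e}_{i,j}+\mathbf{e}_{i+1,j+1}-\mathbf{e}_{i+1,j}-\mathbf{e}_{i,j+1}$.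 The lattice associated to $\mathcal{P}$ is the subgroup $\Lambda=\langle\mathbf{c}_1,\dots,\mathbf{c}_r\rangle\subseteq\mathbb{Z}^{m\times n}$. Its elements are supported on $V(\mathcal{P})$, and the lattice ideal $I_\Lambda\subseteq S$ is the ideal generated by all binomials $x^{\mathbf{a}}-x^{\mathbf{b}}$ with $\mathbf{a},\mathbf{b}$ non-negative integer vectors supported on $V(\mathcal{P})$ and $\mathbf{a}-\mathbf{b}\in\Lambda$. $(I_{\mathcal{P}}:u)=\{f\in S: uf\in I_{\mathcal{P}}\}$. *)

theory Defs
  imports "HOL-Algebra.Algebra" "HOL-Algebra.Free_Abelian_Groups" "HOL-Library.Poly_Mapping"
begin

section \<open>Intervals and collections of cells\<close>

type_synonym vertex = "nat \<times> nat"

definition interval :: "vertex \<Rightarrow> vertex \<Rightarrow> vertex set" where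
  "interval a b = {fst a..fst b} \<times> {snd a..snd b}"

definition proper :: "vertex \<Rightarrow> vertex \<Rightarrow> bool" where
  "proper a b \<longleftrightarrow> fst a < fst b \<and> snd a < snd b"

definition cell :: "vertex \<Rightarrow> vertex set" where
  "cell a = interval a (fst a + 1, snd a + 1)"

lemma cell_eq: "cell (i, j) = {(i, j), (i + 1, j + 1), (i, j + 1), (i + 1, j)}"
  by (auto simp: cell_def interval_def)

text \<open>A collection of cells is a set of subsets of the form \<^term>\<open>cell a\<close>.
  By \<open>cell_eq\<close> every cell coincides with the set of its four corners, so the
  vertex set of a collection is its union.\<close>

definition vertices :: "vertex set set \<Rightarrow> vertex set" where
  "vertices P = \<Union>P"

definition inner_interval :: "vertex set set \<Rightarrow> vertex \<Rightarrow> vertex \<Rightarrow> bool" where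
  "inner_interval P a b \<longleftrightarrow>
     proper a b \<and> (\<forall>e. cell e \<subseteq> interval a b \<longrightarrow> cell e \<in> P)"

section \<open>The polynomial ring on a set of vertices\<close>

text \<open>A polynomial is a finitely supported map from exponent vectors to coefficients, with the
  convolution product of \<^theory>\<open>HOL-Library.Poly_Mapping\<close>.\<close>

type_synonym 'k mpoly = "(vertex \<Rightarrow>\<^sub>0 nat) \<Rightarrow>\<^sub>0 'k"

definition vertex_ring :: "vertex set \<Rightarrow> 'k::field mpoly ring" where
  "vertex_ring V =
     \<lparr>carrier = {f. \<forall>e \<in> Poly_Mapping.keys f. Poly_Mapping.keys e \<subseteq> V},
      monoid.mult = (*), monoid.one = 1, ring.zero = 0, ring.add = (+)\<rparr>"

definition monomial :: "(vertex \<Rightarrow>\<^sub>0 nat) \<Rightarrow> 'k::field mpoly" where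
  "monomial e = Poly_Mapping.single e 1"

definition var :: "vertex \<Rightarrow> 'k::field mpoly" where
  "var v = monomial (Poly_Mapping.single v 1)"

lemma vertex_ring_carrier:
  "f \<in> carrier (vertex_ring V) \<longleftrightarrow> (\<forall>e \<in> Poly_Mapping.keys f. Poly_Mapping.keys e \<subseteq> V)"
  by (simp add: vertex_ring_def)

lemma vertex_ring_simps [simp]:
  "f \<otimes>\<^bsub>vertex_ring V\<^esub> g = f * g" "f \<oplus>\<^bsub>vertex_ring V\<^esub> g = f + g"
  "\<one>\<^bsub>vertex_ring V\<^esub> = 1" "\<zero>\<^bsub>vertex_ring V\<^esub> = 0"
  by (simp_all add: vertex_ring_def)

lemma vertex_ring_cring: "cring (vertex_ring V :: 'k::field mpoly ring)"
proof -
  let ?S = "carrier (vertex_ring V :: 'k mpoly ring)"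
  have add: "f + g \<in> ?S" if "f \<in> ?S" "g \<in> ?S" for f g
    using that Poly_Mapping.keys_add[of f g] unfolding vertex_ring_carrier by blast
  have mult: "f * g \<in> ?S" if f: "f \<in> ?S" and g: "g \<in> ?S" for f g
    unfolding vertex_ring_carrier
  proof
    fix e assume "e \<in> Poly_Mapping.keys (f * g)"
    then obtain a b where ab: "a \<in> Poly_Mapping.keys f" "b \<in> Poly_Mapping.keys g" "e = a + b"
      using keys_mult[of f g] by blast
    then have "Poly_Mapping.keys a \<subseteq> V" "Poly_Mapping.keys b \<subseteq> V"
      using f g unfolding vertex_ring_carrier by blast+
    then show "Poly_Mapping.keys e \<subseteq> V"
      using Poly_Mapping.keys_add[of a b] ab(3) by blast
  qed
  have neg: "- f \<in> ?S" if "f \<in> ?S" for f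
    using that by (simp add: vertex_ring_carrier in_keys_iff)
  have zero: "0 \<in> ?S" and one: "1 \<in> ?S"
    by (auto simp: vertex_ring_carrier)
  show ?thesis
  proof (rule cringI)
    show "abelian_group (vertex_ring V :: 'k mpoly ring)"
    proof (rule abelian_groupI)
      fix f assume "f \<in> ?S"
      then show "\<exists>g \<in> ?S. g \<oplus>\<^bsub>vertex_ring V\<^esub> f = \<zero>\<^bsub>vertex_ring V\<^esub>"
        using neg by (intro bexI[of _ "- f"]) simp_all
    qed (simp_all add: add zero add.assoc add.commute)
    show "Group.comm_monoid (vertex_ring V :: 'k mpoly ring)"
      by (rule comm_monoidI) (simp_all add: mult one mult.assoc mult.commute)
  qed (simp add: distrib_right)
qed

section \<open>The ideals attached to a collection of cells\<close>

definition inner_ideal :: "vertex set set \<Rightarrow> 'k::field mpoly set" where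
  "inner_ideal P = Idl\<^bsub>vertex_ring (vertices P)\<^esub>
     {var (i, j) * var (k, l) - var (i, l) * var (k, j) | i j k l. inner_interval P (i, j) (k, l)}"

text \<open>The group of integer $m \times n$ matrices is the free abelian group on the index set
  \<^term>\<open>interval (1, 1) (m, n)\<close>, with canonical basis given by \<^term>\<open>frag_of\<close>.\<close>

definition cell_vector :: "vertex \<Rightarrow> vertex \<Rightarrow>\<^sub>0 int" where
  "cell_vector a = (case a of (i, j) \<Rightarrow>
     frag_of (i, j) + frag_of (i + 1, j + 1) - frag_of (i + 1, j) - frag_of (i, j + 1))"

definition lattice_of :: "nat \<Rightarrow> nat \<Rightarrow> vertex set set \<Rightarrow> (vertex \<Rightarrow>\<^sub>0 int) set" where
  "lattice_of m n P =
     generate (free_Abelian_group (interval (1, 1) (m, n))) {cell_vector a | a. cell a \<in> P}"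

definition lattice_ideal :: "vertex set \<Rightarrow> (vertex \<Rightarrow>\<^sub>0 int) set \<Rightarrow> 'k::field mpoly set" where
  "lattice_ideal V L = Idl\<^bsub>vertex_ring V\<^esub>
     {monomial a - monomial b | a b.
        Poly_Mapping.keys a \<subseteq> V \<and> Poly_Mapping.keys b \<subseteq> V \<and>
        Poly_Mapping.map int a - Poly_Mapping.map int b \<in> L}"

definition colon_ideal :: "('a, 'b) ring_scheme \<Rightarrow> 'a set \<Rightarrow> 'a \<Rightarrow> 'a set" where
  "colon_ideal R I u = {f \<in> carrier R. u \<otimes>\<^bsub>R\<^esub> f \<in> I}"

end

theory Submission
  imports Defs
begin

text \<open>
  That a colon ideal of \<open>I\<^sub>P\<close> by a monomial lies in the lattice ideal \<open>I\<^sub>\<Lambda>\<close> follows from a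
  description of \<open>I\<^sub>\<Lambda>\<close> by coset sums: a polynomial \<open>f\<close> lies in \<open>I\<^sub>\<Lambda>\<close> iff, for every coset
  of \<open>\<Lambda>\<close>, the coefficients of \<open>f\<close> at the exponents in that coset add up to zero
  (\<open>lattice_ideal_iff\<close>). Multiplication by a monomial only translates cosets, so \<open>I\<^sub>\<Lambda>\<close> is
  saturated with respect to every monomial (\<open>lattice_ideal_saturated\<close>). The exponent vector of
  the binomial of an inner interval is the sum of the vectors of the cells in the interval, whence
  \<open>I\<^sub>P \<subseteq> I\<^sub>\<Lambda>\<close>, and saturation gives \<open>(I\<^sub>P : x\<^sup>w) \<subseteq> I\<^sub>\<Lambda>\<close> for every \<open>w\<close>.

  For the other inclusion, call \<open>(a, b)\<close> a lattice pair if \<open>a - b \<in> \<Lambda>\<close>. Every lattice pair has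
  its own \<open>w\<close> with \<open>x\<^sup>w (x\<^sup>a - x\<^sup>b) \<in> I\<^sub>P\<close>: this holds for some pair representing a given
  element of \<open>\<Lambda>\<close>, by induction on the way the element is generated by cell vectors, and then for
  all pairs representing it (\<open>lattice_pair_annihilated\<close>). One \<open>w\<close> serves all lattice pairs
  because they form a monoid in which \<open>(a', b') \<le> (a, b)\<close> can be subtracted, so that by Dickson's
  lemma the monoid is generated by finitely many (\<open>uniform_annihilator\<close>); and
  \<open>x\<^sup>a\<^sup>+\<^sup>c - x\<^sup>b\<^sup>+\<^sup>d = x\<^sup>c (x\<^sup>a - x\<^sup>b) + x\<^sup>b (x\<^sup>c - x\<^sup>d)\<close>.
\<close>

section \<open>Monomials and integer exponents\<close>

text \<open>The integer vector of a monomial exponent, in which differences can be formed without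
  truncation.\<close>

abbreviation int_exp :: "(vertex \<Rightarrow>\<^sub>0 nat) \<Rightarrow> (vertex \<Rightarrow>\<^sub>0 int)" where
  "int_exp \<equiv> Poly_Mapping.map int"

lemma lookup_int_exp [simp]: "Poly_Mapping.lookup (int_exp a) v = int (Poly_Mapping.lookup a v)"
  by (simp add: map.rep_eq when_def)

lemma int_exp_add [simp]: "int_exp (a + b) = int_exp a + int_exp b"
  by (rule poly_mapping_eqI) (simp add: lookup_add)

lemma int_exp_zero [simp]: "int_exp 0 = 0"
  by (rule poly_mapping_eqI) simp

lemma int_exp_single [simp]: "int_exp (Poly_Mapping.single v 1) = frag_of v"
  by (rule poly_mapping_eqI) (simp add: lookup_single when_def)

lemma int_exp_inject: "int_exp a = int_exp b \<longleftrightarrow> a = b"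
  by (metis lookup_int_exp of_nat_eq_iff poly_mapping_eqI)

lemma monomial_add: "monomial (a + b) = monomial a * monomial b"
  by (simp add: monomial_def mult_single)

lemma monomial_zero [simp]: "monomial 0 = 1"
  by (simp add: monomial_def)

lemma monomial_carrier:
  "Poly_Mapping.keys e \<subseteq> V \<Longrightarrow> monomial e \<in> carrier (vertex_ring V)"
  by (simp add: vertex_ring_carrier monomial_def)

lemma uminus_carrier: "f \<in> carrier (vertex_ring V) \<Longrightarrow> - f \<in> carrier (vertex_ring V)"
  by (simp add: vertex_ring_carrier in_keys_iff)

lemma minus_carrier:
  assumes "f \<in> carrier (vertex_ring V)" "g \<in> carrier (vertex_ring V)"
  shows "f - g \<in> carrier (vertex_ring V)"
proof -
  interpret cring "vertex_ring V" by (rule vertex_ring_cring)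
  show ?thesis
    using add.m_closed[OF assms(1) uminus_carrier[OF assms(2)]] by simp
qed

lemma keys_add_subset:
  fixes a b :: "vertex \<Rightarrow>\<^sub>0 nat"
  shows "Poly_Mapping.keys a \<subseteq> V \<Longrightarrow> Poly_Mapping.keys b \<subseteq> V \<Longrightarrow> Poly_Mapping.keys (a + b) \<subseteq> V"
  using Poly_Mapping.keys_add[of a b] by blast

lemma mpoly_sum_induct [case_names single sum]:
  fixes f :: "'k::field mpoly"
  assumes single: "\<And>t c. Q (Poly_Mapping.single t c)"
    and sum: "\<And>f g. Q f \<Longrightarrow> Q g \<Longrightarrow> Q (f + g)"
  shows "Q f"
proof (induction f rule: update_induct)
  case const
  show ?case using single[of 0 0] by simp
next
  case (update f a b)
  have "Poly_Mapping.update a b f = f + Poly_Mapping.single a b"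
    using update(1) by (intro poly_mapping_eqI)
      (auto simp: lookup_update lookup_add lookup_single when_def in_keys_iff)
  then show ?case using sum[OF update(3) single] by simp
qed

section \<open>Ideals of the polynomial ring\<close>

lemma vertex_ring_a_inv:
  assumes "f \<in> carrier (vertex_ring V)"
  shows "\<ominus>\<^bsub>vertex_ring V\<^esub> f = - f"
proof -
  interpret cring "vertex_ring V" by (rule vertex_ring_cring)
  show ?thesis
    using assms by (intro minus_equality) (simp_all add: uminus_carrier)
qed

lemma vertex_ring_idealI:
  assumes sub: "A \<subseteq> carrier (vertex_ring V)"
    and zero_in: "0 \<in> A"
    and add: "\<And>f g. f \<in> A \<Longrightarrow> g \<in> A \<Longrightarrow> f + g \<in> A"
    and mult: "\<And>f g. f \<in> A \<Longrightarrow> g \<in> carrier (vertex_ring V) \<Longrightarrow> g * f \<in> A"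
  shows "ideal A (vertex_ring V)"
proof (rule idealI)
  interpret cring "vertex_ring V" by (rule vertex_ring_cring)
  show "ring (vertex_ring V)" by (rule ring_axioms)
  have neg: "- f \<in> A" if "f \<in> A" for f
    using mult[OF that uminus_carrier[OF one_closed]] by simp
  show "subgroup A (add_monoid (vertex_ring V))"
  proof
    show "A \<subseteq> carrier (add_monoid (vertex_ring V))" using sub by simp
    show "x \<otimes>\<^bsub>add_monoid (vertex_ring V)\<^esub> y \<in> A" if "x \<in> A" "y \<in> A" for x y
      using add that by simp
    show "\<one>\<^bsub>add_monoid (vertex_ring V)\<^esub> \<in> A" using zero_in by simp
    show "inv\<^bsub>add_monoid (vertex_ring V)\<^esub> x \<in> A" if "x \<in> A" for x
      using vertex_ring_a_inv[of x V] neg[OF that] sub that by (auto simp: a_inv_def)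
  qed
qed (use mult in \<open>simp_all add: mult.commute\<close>)

lemma vertex_ring_ideal_closed:
  assumes "ideal A (vertex_ring V)"
  shows "A \<subseteq> carrier (vertex_ring V)" and "0 \<in> A"
    and "f \<in> A \<Longrightarrow> g \<in> A \<Longrightarrow> f + g \<in> A"
    and "f \<in> A \<Longrightarrow> g \<in> carrier (vertex_ring V) \<Longrightarrow> g * f \<in> A"
    and "f \<in> A \<Longrightarrow> - f \<in> A"
proof -
  interpret ideal A "vertex_ring V" by (rule assms)
  show "A \<subseteq> carrier (vertex_ring V)" by (rule a_subset)
  show "0 \<in> A" using additive_subgroup.zero_closed[OF is_additive_subgroup] by simp
  show "f \<in> A \<Longrightarrow> g \<in> A \<Longrightarrow> f + g \<in> A" using additive_subgroup.a_closed[OF is_additive_subgroup, of f g] by simp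
  show mult: "f \<in> A \<Longrightarrow> g \<in> carrier (vertex_ring V) \<Longrightarrow> g * f \<in> A" for f g
    using I_l_closed[of f g] by simp
  show "f \<in> A \<Longrightarrow> - f \<in> A"
    using mult[of f "- 1"] uminus_carrier[OF one_closed] by simp
qed

lemma colon_ideal_ideal:
  assumes I: "ideal I (vertex_ring V)" and u: "u \<in> carrier (vertex_ring V)"
  shows "ideal (colon_ideal (vertex_ring V) I u) (vertex_ring V)"
proof -
  interpret cring "vertex_ring V" by (rule vertex_ring_cring)
  note I = vertex_ring_ideal_closed[OF I]
  show ?thesis
  proof (rule vertex_ring_idealI)
    show "0 \<in> colon_ideal (vertex_ring V) I u"
      using zero_closed I(2) by (simp add: colon_ideal_def)
    show "f + g \<in> colon_ideal (vertex_ring V) I u"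
      if "f \<in> colon_ideal (vertex_ring V) I u" "g \<in> colon_ideal (vertex_ring V) I u" for f g
      using that add.m_closed[of f g] I(3) by (simp add: colon_ideal_def distrib_left)
    show "g * f \<in> colon_ideal (vertex_ring V) I u"
      if "f \<in> colon_ideal (vertex_ring V) I u" "g \<in> carrier (vertex_ring V)" for f g
      using that m_closed[of g f] I(4)[of "u * f" g] by (simp add: colon_ideal_def ac_simps)
  qed (auto simp: colon_ideal_def)
qed

section \<open>Lattice ideals and coset sums\<close>

text \<open>The sum of the coefficients of \<open>f\<close> at the exponents in the coset of \<open>z\<close> modulo \<open>L\<close>.\<close>

definition coset_sum :: "(vertex \<Rightarrow>\<^sub>0 int) set \<Rightarrow> (vertex \<Rightarrow>\<^sub>0 int) \<Rightarrow> 'k::field mpoly \<Rightarrow> 'k" where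
  "coset_sum L z f = (\<Sum>e | e \<in> Poly_Mapping.keys f \<and> int_exp e - z \<in> L. Poly_Mapping.lookup f e)"

lemma coset_sum_superset:
  assumes "finite A" "Poly_Mapping.keys f \<subseteq> A"
  shows "coset_sum L z f = (\<Sum>e | e \<in> A \<and> int_exp e - z \<in> L. Poly_Mapping.lookup f e)"
  unfolding coset_sum_def using assms
  by (intro sum.mono_neutral_left) (auto simp: in_keys_iff)

lemma coset_sum_add:
  fixes f g :: "'k::field mpoly"
  shows "coset_sum L z (f + g) = coset_sum L z f + coset_sum L z g"
proof -
  let ?A = "Poly_Mapping.keys f \<union> Poly_Mapping.keys g"
  have "coset_sum L z h = (\<Sum>e | e \<in> ?A \<and> int_exp e - z \<in> L. Poly_Mapping.lookup h e)"
    if "Poly_Mapping.keys h \<subseteq> ?A" for h :: "'k mpoly"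
    using that by (intro coset_sum_superset) auto
  then show ?thesis
    using Poly_Mapping.keys_add[of f g] by (simp add: lookup_add sum.distrib)
qed

lemma coset_sum_zero [simp]: "coset_sum L z 0 = 0"
  by (simp add: coset_sum_def)

lemma coset_sum_single:
  "coset_sum L z (Poly_Mapping.single e c) = (if int_exp e - z \<in> L then c else 0)"
proof -
  have "coset_sum L z (Poly_Mapping.single e c)
      = (\<Sum>e' | e' \<in> {e} \<and> int_exp e' - z \<in> L. Poly_Mapping.lookup (Poly_Mapping.single e c) e')"
    by (rule coset_sum_superset) auto
  also have "{e'. e' \<in> {e} \<and> int_exp e' - z \<in> L} = (if int_exp e - z \<in> L then {e} else {})"
    by auto
  finally show ?thesis by simp
qed

lemma coset_sum_single_mult:
  "coset_sum L z (Poly_Mapping.single t c * f) = c * coset_sum L (z - int_exp t) f"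
proof (induction f rule: mpoly_sum_induct)
  case (single e d)
  show ?case by (simp add: mult_single coset_sum_single algebra_simps)
next
  case (sum f g)
  then show ?case by (simp add: distrib_left coset_sum_add)
qed

lemma coset_sum_mult_eq_zero:
  assumes "\<And>z. coset_sum L z f = 0"
  shows "coset_sum L z (g * f) = 0"
proof (induction g rule: mpoly_sum_induct)
  case (single t c)
  show ?case by (simp add: coset_sum_single_mult assms)
next
  case (sum g h)
  then show ?case by (simp add: distrib_right coset_sum_add)
qed

text \<open>A lattice is given as a set of integer vectors closed under differences, without reference to
  a finite set of coordinates.\<close>

locale exponent_lattice =
  fixes L :: "(vertex \<Rightarrow>\<^sub>0 int) set"
  assumes zero: "0 \<in> L" and diff: "x \<in> L \<Longrightarrow> y \<in> L \<Longrightarrow> x - y \<in> L"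
begin

lemma uminus: "x \<in> L \<Longrightarrow> - x \<in> L"
  using diff[OF zero] by simp

lemma add: "x \<in> L \<Longrightarrow> y \<in> L \<Longrightarrow> x + y \<in> L"
  using diff[of x "- y"] uminus by simp

lemma translate_iff: "x - y \<in> L \<Longrightarrow> x - z \<in> L \<longleftrightarrow> y - z \<in> L"
  using add[of "x - y" "y - z"] diff[of "x - z" "x - y"] by auto

lemma lattice_ideal_ideal: "ideal (lattice_ideal V L) (vertex_ring V)"
proof -
  interpret cring "vertex_ring V" by (rule vertex_ring_cring)
  show ?thesis
    unfolding lattice_ideal_def
    by (intro genideal_ideal) (auto intro: minus_carrier monomial_carrier)
qed

lemma binomial_in_lattice_ideal:
  assumes "Poly_Mapping.keys a \<subseteq> V" "Poly_Mapping.keys b \<subseteq> V" "int_exp a - int_exp b \<in> L"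
  shows "monomial a - monomial b \<in> lattice_ideal V L"
  unfolding lattice_ideal_def genideal_def using assms by blast

lemma coset_sum_binomial:
  assumes "int_exp a - int_exp b \<in> L"
  shows "coset_sum L z (Poly_Mapping.single a c - Poly_Mapping.single b c) = 0"
proof -
  have *: "Poly_Mapping.single a c - Poly_Mapping.single b c
      = Poly_Mapping.single a c + Poly_Mapping.single b (- c)"
    by (simp add: single_uminus)
  show ?thesis
    unfolding * coset_sum_add coset_sum_single using translate_iff[OF assms] by simp
qed

lemma lattice_ideal_iff:
  "f \<in> lattice_ideal V L \<longleftrightarrow>
    f \<in> carrier (vertex_ring V) \<and> (\<forall>z. coset_sum L z f = 0)" (is "_ \<longleftrightarrow> _ \<and> ?Z f")
proof
  interpret cring "vertex_ring V" by (rule vertex_ring_cring)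
  let ?J = "{f \<in> carrier (vertex_ring V). ?Z f}"
  have "ideal ?J (vertex_ring V)"
  proof (rule vertex_ring_idealI)
    show "0 \<in> ?J" using zero_closed by simp
    show "f + g \<in> ?J" if "f \<in> ?J" "g \<in> ?J" for f g
      using that add.m_closed[of f g] by (simp add: coset_sum_add)
    show "g * f \<in> ?J" if "f \<in> ?J" "g \<in> carrier (vertex_ring V)" for f g
      using that m_closed[of g f] by (simp add: coset_sum_mult_eq_zero)
  qed auto
  moreover have "monomial a - monomial b \<in> ?J"
    if "Poly_Mapping.keys a \<subseteq> V" "Poly_Mapping.keys b \<subseteq> V" "int_exp a - int_exp b \<in> L" for a b
    using that vertex_ring_ideal_closed(1)[OF lattice_ideal_ideal, of V]
      binomial_in_lattice_ideal[OF that]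
    by (auto simp: monomial_def coset_sum_binomial)
  ultimately have "lattice_ideal V L \<subseteq> ?J"
    unfolding lattice_ideal_def by (intro genideal_minimal) auto
  then show "f \<in> lattice_ideal V L \<Longrightarrow> f \<in> carrier (vertex_ring V) \<and> ?Z f"
    by blast
next
  note I = vertex_ring_ideal_closed[OF lattice_ideal_ideal[of V]]
  assume "f \<in> carrier (vertex_ring V) \<and> ?Z f"
  then show "f \<in> lattice_ideal V L"
  proof (induction "card (Poly_Mapping.keys f)" arbitrary: f rule: less_induct)
    case less
    show ?case
    proof (cases "f = 0")
      case True
      then show ?thesis using I(2) by simp
    next
      case False
      then obtain a where a: "a \<in> Poly_Mapping.keys f" by fastforce
      let ?A = "{e. e \<in> Poly_Mapping.keys f \<and> int_exp e - int_exp a \<in> L}"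
      \<comment> \<open>A single exponent in the coset of \<open>a\<close> would contribute a nonzero coset sum.\<close>
      have "?A \<noteq> {a}"
      proof
        assume "?A = {a}"
        then have "coset_sum L (int_exp a) f = Poly_Mapping.lookup f a"
          by (simp add: coset_sum_def)
        then show False using less.prems a by (simp add: in_keys_iff)
      qed
      moreover have "a \<in> ?A" using a zero by simp
      ultimately obtain b where b: "b \<in> Poly_Mapping.keys f" "int_exp b - int_exp a \<in> L" "b \<noteq> a"
        by blast
      define c where "c = Poly_Mapping.lookup f a"
      define h where "h = Poly_Mapping.single a c - Poly_Mapping.single b c"
      have ab: "int_exp a - int_exp b \<in> L" using uminus[OF b(2)] by simp
      have V: "Poly_Mapping.keys a \<subseteq> V" "Poly_Mapping.keys b \<subseteq> V"
        using a b less.prems by (auto simp: vertex_ring_carrier)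
      have "Poly_Mapping.single 0 c * (monomial a - monomial b) = h"
        by (simp add: h_def monomial_def right_diff_distrib mult_single)
      moreover have "Poly_Mapping.single 0 c \<in> carrier (vertex_ring V)"
        by (auto simp: vertex_ring_carrier)
      ultimately have h: "h \<in> lattice_ideal V L"
        using I(4)[OF binomial_in_lattice_ideal[OF V ab]] by metis
      have "Poly_Mapping.keys (f - h) \<subseteq> Poly_Mapping.keys f - {a}"
      proof
        fix e assume "e \<in> Poly_Mapping.keys (f - h)"
        then show "e \<in> Poly_Mapping.keys f - {a}"
          using b by (cases "e = a"; cases "e = b")
            (auto simp: in_keys_iff h_def c_def lookup_minus lookup_single when_def)
      qed
      moreover from this have "card (Poly_Mapping.keys (f - h)) < card (Poly_Mapping.keys f)"
        using a by (intro psubset_card_mono) auto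
      moreover have "coset_sum L z (f - h) = 0" for z
        using less.prems coset_sum_add[of L z "f - h" h] coset_sum_binomial[OF ab, of z c]
        by (simp add: h_def)
      ultimately have "f - h \<in> lattice_ideal V L"
        using less.prems by (intro less.hyps) (auto simp: vertex_ring_carrier)
      then show ?thesis using I(3)[OF _ h] by force
    qed
  qed
qed

lemma lattice_ideal_saturated:
  assumes "f \<in> carrier (vertex_ring V)" "monomial w * f \<in> lattice_ideal V L"
  shows "f \<in> lattice_ideal V L"
proof -
  have "coset_sum L z f = coset_sum L (z + int_exp w) (monomial w * f)" for z
    by (simp add: monomial_def coset_sum_single_mult)
  then show ?thesis using assms by (simp add: lattice_ideal_iff)
qed

end

section \<open>Dickson's lemma and a common monomial multiplier\<close>

text \<open>The vectors are given by a family \<open>h\<close> and compared on a finite index set \<open>J\<close>.\<close>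

lemma dickson:
  fixes h :: "'a \<Rightarrow> 'i \<Rightarrow> nat"
  assumes "finite J"
  shows "\<exists>B\<subseteq>A. finite B \<and> (\<forall>a\<in>A. \<exists>b\<in>B. \<forall>i\<in>J. h b i \<le> h a i)"
  using assms
proof (induction J arbitrary: A)
  case empty
  show ?case
  proof (cases "A = {}")
    case False
    then obtain a where "a \<in> A" by blast
    then show ?thesis by (intro exI[of _ "{a}"]) auto
  qed auto
next
  case (insert x J)
  obtain B where B: "B \<subseteq> A" "finite B" "\<forall>a\<in>A. \<exists>b\<in>B. \<forall>i\<in>J. h b i \<le> h a i"
    using insert.IH[of A] by blast
  obtain N where N: "\<forall>b\<in>B. h b x \<le> N"
    using finite_nat_set_iff_bounded_le[of "(\<lambda>b. h b x) ` B"] B(2) by auto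
  \<comment> \<open>The set \<open>B\<close> takes care of the elements with large \<open>x\<close>-coordinate; the others lie in
    finitely many slices, on which the \<open>x\<close>-coordinate is constant.\<close>
  define good where "good t C \<longleftrightarrow> C \<subseteq> {a\<in>A. h a x = t} \<and> finite C \<and>
      (\<forall>a\<in>{a\<in>A. h a x = t}. \<exists>b\<in>C. \<forall>i\<in>J. h b i \<le> h a i)" for t C
  have "\<exists>C. good t C" for t
    unfolding good_def by (rule insert.IH)
  then obtain C where "\<And>t. good t (C t)" by metis
  then have C: "\<And>t. C t \<subseteq> {a\<in>A. h a x = t}" "\<And>t. finite (C t)"
    "\<And>t. \<forall>a\<in>{a\<in>A. h a x = t}. \<exists>b\<in>C t. \<forall>i\<in>J. h b i \<le> h a i"
    by (auto simp: good_def)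
  show ?case
  proof (intro exI conjI ballI)
    show "B \<union> (\<Union>t<N. C t) \<subseteq> A" using B C by blast
    show "finite (B \<union> (\<Union>t<N. C t))" using B C by blast
    fix a assume a: "a \<in> A"
    show "\<exists>b\<in>B \<union> (\<Union>t<N. C t). \<forall>i\<in>insert x J. h b i \<le> h a i"
    proof (cases "h a x < N")
      case True
      obtain b where b: "b \<in> C (h a x)" "\<forall>i\<in>J. h b i \<le> h a i"
        using C(3)[of "h a x"] a by blast
      then have "h b x = h a x" using C(1) by blast
      then show ?thesis using b True by (intro bexI[of _ b]) auto
    next
      case False
      obtain b where "b \<in> B" "\<forall>i\<in>J. h b i \<le> h a i" using B(3) a by blast
      then show ?thesis using N False by (intro bexI[of _ b]) force+
    qed
  qed
qed

lemma common_annihilator: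
  assumes I: "ideal I (vertex_ring V)" and "finite F"
    and "\<forall>f\<in>F. \<exists>w. Poly_Mapping.keys w \<subseteq> V \<and> monomial w * f \<in> I"
  shows "\<exists>w. Poly_Mapping.keys w \<subseteq> V \<and> (\<forall>f\<in>F. monomial w * f \<in> I)"
  using assms(2,3)
proof (induction F)
  case empty
  then show ?case by (intro exI[of _ 0]) auto
next
  case (insert f F)
  note mult = vertex_ring_ideal_closed(4)[OF I]
  obtain w where w: "Poly_Mapping.keys w \<subseteq> V" "\<forall>f\<in>F. monomial w * f \<in> I"
    using insert by auto
  obtain w' where w': "Poly_Mapping.keys w' \<subseteq> V" "monomial w' * f \<in> I"
    using insert.prems by auto
  have "monomial (w + w') * g \<in> I" if "g \<in> insert f F" for g
  proof (cases "g = f")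
    case True
    then show ?thesis
      using mult[OF w'(2) monomial_carrier[OF w(1)]] by (simp add: monomial_add mult.assoc)
  next
    case False
    then have "monomial w * g \<in> I" using that w by auto
    from mult[OF this monomial_carrier[OF w'(1)]] show ?thesis
      by (simp add: monomial_add ac_simps)
  qed
  then show ?case using keys_add_subset[OF w(1) w'(1)] by blast
qed

text \<open>Dickson's lemma is applied to the nonzero lattice pairs, as vectors indexed by two copies of
  \<open>V\<close>. The induction is on the total degree of the pair.\<close>

lemma (in exponent_lattice) uniform_annihilator:
  fixes I :: "'k::field mpoly set"
  assumes I: "ideal I (vertex_ring V)" and "finite V"
    and pairs: "\<And>a b. \<lbrakk>Poly_Mapping.keys a \<subseteq> V; Poly_Mapping.keys b \<subseteq> V; int_exp a - int_exp b \<in> L\<rbrakk>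
      \<Longrightarrow> \<exists>w. Poly_Mapping.keys w \<subseteq> V \<and> monomial w * (monomial a - monomial b) \<in> I"
  shows "\<exists>w. Poly_Mapping.keys w \<subseteq> V \<and> (\<forall>a b. Poly_Mapping.keys a \<subseteq> V \<longrightarrow> Poly_Mapping.keys b \<subseteq> V \<longrightarrow>
    int_exp a - int_exp b \<in> L \<longrightarrow> monomial w * (monomial a - monomial b) \<in> I)"
proof -
  note I' = vertex_ring_ideal_closed[OF I]
  define M where "M = {(a, b). Poly_Mapping.keys a \<subseteq> V \<and> Poly_Mapping.keys b \<subseteq> V \<and>
    int_exp a - int_exp b \<in> L \<and> (a, b) \<noteq> (0, 0)}"
  define h :: "(vertex \<Rightarrow>\<^sub>0 nat) \<times> (vertex \<Rightarrow>\<^sub>0 nat) \<Rightarrow> vertex + vertex \<Rightarrow> nat"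
    where "h = (\<lambda>(a, b). case_sum (Poly_Mapping.lookup a) (Poly_Mapping.lookup b))"
  obtain B where B: "B \<subseteq> M" "finite B" "\<forall>p\<in>M. \<exists>q\<in>B. \<forall>i\<in>Sum_Type.Plus V V. h q i \<le> h p i"
    using dickson[OF finite_Plus[OF \<open>finite V\<close> \<open>finite V\<close>], of M h] by blast
  define bin where "bin = (\<lambda>(a, b). monomial a - monomial b :: 'k mpoly)"
  have "\<forall>f\<in>bin ` B. \<exists>w. Poly_Mapping.keys w \<subseteq> V \<and> monomial w * f \<in> I"
  proof
    fix f assume "f \<in> bin ` B"
    then obtain a b where "f = monomial a - monomial b" "(a, b) \<in> M"
      using B(1) by (auto simp: bin_def)
    then show "\<exists>w. Poly_Mapping.keys w \<subseteq> V \<and> monomial w * f \<in> I"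
      using pairs[of a b] by (simp add: M_def)
  qed
  from common_annihilator[OF I finite_imageI[OF B(2)] this]
  obtain w where w: "Poly_Mapping.keys w \<subseteq> V" "\<And>p. p \<in> B \<Longrightarrow> monomial w * bin p \<in> I"
    by auto
  have "monomial w * (monomial a - monomial b) \<in> I"
    if "Poly_Mapping.keys a \<subseteq> V" "Poly_Mapping.keys b \<subseteq> V" "int_exp a - int_exp b \<in> L" for a b
    using that
  proof (induction "\<Sum>v\<in>V. Poly_Mapping.lookup a v + Poly_Mapping.lookup b v"
      arbitrary: a b rule: less_induct)
    case less
    show ?case
    proof (cases "(a, b) = (0, 0)")
      case True
      then show ?thesis using I'(2) by simp
    next
      case False
      then have "(a, b) \<in> M" using less.prems by (simp add: M_def)
      from bspec[OF B(3) this] obtain q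
        where q: "q \<in> B" "\<forall>i\<in>Sum_Type.Plus V V. h q i \<le> h (a, b) i" by (rule bexE)
      obtain c d where "q = (c, d)" by (rule prod.exhaust)
      then have cd: "(c, d) \<in> B" "\<forall>i\<in>Sum_Type.Plus V V. h (c, d) i \<le> h (a, b) i"
        using q by simp_all
      have cdM: "Poly_Mapping.keys c \<subseteq> V" "Poly_Mapping.keys d \<subseteq> V" "int_exp c - int_exp d \<in> L"
        "(c, d) \<noteq> (0, 0)"
        using cd(1) B(1) by (auto simp: M_def)
      have "Poly_Mapping.lookup c v \<le> Poly_Mapping.lookup a v \<and>
          Poly_Mapping.lookup d v \<le> Poly_Mapping.lookup b v" for v
      proof (cases "v \<in> V")
        case True
        then show ?thesis
          using bspec[OF cd(2), of "Inl v"] bspec[OF cd(2), of "Inr v"] by (auto simp: h_def)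
      next
        case False
        then have "v \<notin> Poly_Mapping.keys c" "v \<notin> Poly_Mapping.keys d" using cdM(1,2) by blast+
        then show ?thesis by (simp add: in_keys_iff)
      qed
      then have le: "Poly_Mapping.lookup c v \<le> Poly_Mapping.lookup a v"
        "Poly_Mapping.lookup d v \<le> Poly_Mapping.lookup b v" for v
        by simp_all
      have split: "a = c + (a - c)" "b = d + (b - d)"
        by (rule poly_mapping_eqI; simp add: lookup_add lookup_minus le)+
      have keys_minus: "Poly_Mapping.keys (e - e') \<subseteq> Poly_Mapping.keys e"
        for e e' :: "vertex \<Rightarrow>\<^sub>0 nat"
        by (rule subsetI) (simp add: in_keys_iff lookup_minus)
      have keys: "Poly_Mapping.keys (a - c) \<subseteq> V" "Poly_Mapping.keys (b - d) \<subseteq> V"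
        using subset_trans[OF keys_minus less.prems(1)] subset_trans[OF keys_minus less.prems(2)] .
      have "int_exp (a - c) - int_exp (b - d) = (int_exp a - int_exp b) - (int_exp c - int_exp d)"
        unfolding arg_cong[OF split(1), of int_exp, unfolded int_exp_add]
          arg_cong[OF split(2), of int_exp, unfolded int_exp_add] by simp
      then have L: "int_exp (a - c) - int_exp (b - d) \<in> L"
        using diff[OF less.prems(3) cdM(3)] by simp
      obtain v where v: "Poly_Mapping.lookup c v \<noteq> 0 \<or> Poly_Mapping.lookup d v \<noteq> 0"
        using cdM(4) by (metis lookup_zero poly_mapping_eqI)
      then have "v \<in> V" using cdM(1,2) by (auto simp: in_keys_iff)
      then have "(\<Sum>v\<in>V. Poly_Mapping.lookup (a - c) v + Poly_Mapping.lookup (b - d) v)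
          < (\<Sum>v\<in>V. Poly_Mapping.lookup a v + Poly_Mapping.lookup b v)"
      proof (intro sum_strict_mono_ex1 ballI)
        show "\<exists>v\<in>V. Poly_Mapping.lookup (a - c) v + Poly_Mapping.lookup (b - d) v
            < Poly_Mapping.lookup a v + Poly_Mapping.lookup b v"
          using v le[of v] \<open>v \<in> V\<close> by (intro bexI[of _ v]) (auto simp: lookup_minus)
      qed (simp_all add: lookup_minus add_mono \<open>finite V\<close>)
      then have IH: "monomial w * (monomial (a - c) - monomial (b - d)) \<in> I"
        using less.hyps[OF _ keys L] by blast
      have cd_I: "monomial w * (monomial c - monomial d) \<in> I"
        using w(2)[OF cd(1)] by (simp add: bin_def)
      \<comment> \<open>The pair \<open>(a, b)\<close> is the sum of \<open>(c, d)\<close> and \<open>(a - c, b - d)\<close>.\<close>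
      have "monomial (a - c) * (monomial w * (monomial c - monomial d)) +
          monomial d * (monomial w * (monomial (a - c) - monomial (b - d))) \<in> I"
        using keys(1) cdM(2) by (intro I'(3) I'(4)[OF IH] I'(4)[OF cd_I] monomial_carrier)
      also have "monomial (a - c) * (monomial w * (monomial c - monomial d)) +
          monomial d * (monomial w * (monomial (a - c) - monomial (b - d))) =
          monomial w * (monomial (c + (a - c)) - monomial (d + (b - d)))"
        by (simp add: monomial_add algebra_simps)
      finally show ?thesis by (simp flip: split)
    qed
  qed
  then show ?thesis using w(1) by blast
qed

section \<open>Cells and inner intervals\<close>

lemma cell_subset_vertices: "cell a \<in> P \<Longrightarrow> cell a \<subseteq> vertices P"
  by (auto simp: vertices_def)

lemma inner_interval_cell:
  assumes "cell (i, j) \<in> P"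
  shows "inner_interval P (i, j) (i + 1, j + 1)"
proof -
  have "e = (i, j)" if "cell e \<subseteq> interval (i, j) (i + 1, j + 1)" for e
    using that by (cases e) (auto simp: cell_eq interval_def)
  then show ?thesis using assms by (auto simp: inner_interval_def proper_def)
qed

lemma inner_interval_cells:
  assumes "inner_interval P (i, j) (k, l)" "i \<le> r" "r < k" "j \<le> s" "s < l"
  shows "cell (r, s) \<in> P"
  using assms by (auto simp: inner_interval_def cell_eq interval_def)

lemma inner_interval_corners:
  assumes "inner_interval P (i, j) (k, l)"
  shows "{(i, j), (k, l), (i, l), (k, j)} \<subseteq> vertices P"
proof -
  have "i < k" "j < l" using assms by (auto simp: inner_interval_def proper_def)
  then obtain k' l' where kl: "k = k' + 1" "l = l' + 1" "i \<le> k'" "j \<le> l'"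
    by (metis Suc_eq_plus1 less_imp_Suc_add le_add1)
  have "cell (r, s) \<subseteq> vertices P" if "r \<in> {i, k'}" "s \<in> {j, l'}" for r s
    using that kl by (intro cell_subset_vertices inner_interval_cells[OF assms]) auto
  from this[of i j] this[of i l'] this[of k' j] this[of k' l'] show ?thesis
    using kl by (auto simp: cell_eq)
qed

text \<open>The vector of an interval is the sum of the vectors of its cells: \<open>strip\<close> adds up the cells
  between two consecutive values of the first coordinate, and the strips are then added up.\<close>

lemma interval_vector_telescope:
  fixes L :: "(vertex \<Rightarrow>\<^sub>0 int) set"
  assumes zero: "0 \<in> L" and add: "\<And>x y. x \<in> L \<Longrightarrow> y \<in> L \<Longrightarrow> x + y \<in> L"
    and cells: "\<And>r s. \<lbrakk>i \<le> r; r < k; j \<le> s; s < l\<rbrakk> \<Longrightarrow> cell_vector (r, s) \<in> L"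
    and "i \<le> k" "j \<le> l"
  shows "frag_of (i, j) + frag_of (k, l) - frag_of (k, j) - frag_of (i, l) \<in> L"
proof -
  define D :: "nat \<Rightarrow> nat \<Rightarrow> nat \<Rightarrow> vertex \<Rightarrow>\<^sub>0 int"
    where "D r r' s = frag_of (r, j) + frag_of (r', s) - frag_of (r', j) - frag_of (r, s)" for r r' s
  have strip: "D r (r + 1) s \<in> L" if "j \<le> s" "s \<le> l" "i \<le> r" "r < k" for r s
    using that
  proof (induction s rule: dec_induct)
    case base
    then show ?case using zero by (simp add: D_def)
  next
    case (step s)
    have "D r (r + 1) (Suc s) = D r (r + 1) s + cell_vector (r, s)"
      by (simp add: D_def cell_vector_def)
    then show ?case using step add cells by simp
  qed
  have "D i r l \<in> L" if "i \<le> r" "r \<le> k" for r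
    using that
  proof (induction r rule: dec_induct)
    case base
    then show ?case using zero by (simp add: D_def)
  next
    case (step r)
    have "D i (Suc r) l = D i r l + D r (r + 1) l"
      by (simp add: D_def)
    then show ?case using step add strip[of l r] \<open>j \<le> l\<close> by simp
  qed
  then show ?thesis using \<open>i \<le> k\<close> by (simp add: D_def)
qed

lemma var_binomial:
  "var p * var q - var r * var s =
    monomial (Poly_Mapping.single p 1 + Poly_Mapping.single q 1) -
    monomial (Poly_Mapping.single r 1 + Poly_Mapping.single s 1)"
  by (simp add: var_def monomial_add)

lemma keys_two_variables:
  fixes p q :: vertex
  shows "p \<in> V \<Longrightarrow> q \<in> V \<Longrightarrow>
    Poly_Mapping.keys (Poly_Mapping.single p (1::nat) + Poly_Mapping.single q 1) \<subseteq> V"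
  by (intro keys_add_subset) auto

lemma inner_binomial_carrier:
  assumes "inner_interval P (i, j) (k, l)"
  shows "var (i, j) * var (k, l) - var (i, l) * var (k, j) \<in> carrier (vertex_ring (vertices P))"
  unfolding var_binomial using inner_interval_corners[OF assms]
  by (intro minus_carrier monomial_carrier keys_two_variables) auto

lemma inner_ideal_ideal: "ideal (inner_ideal P) (vertex_ring (vertices P))"
proof -
  interpret cring "vertex_ring (vertices P)" by (rule vertex_ring_cring)
  show ?thesis
    unfolding inner_ideal_def using inner_binomial_carrier by (intro genideal_ideal) auto
qed

lemma inner_binomial_in_inner_ideal:
  "inner_interval P (i, j) (k, l) \<Longrightarrow>
    var (i, j) * var (k, l) - var (i, l) * var (k, j) \<in> inner_ideal P"
  unfolding inner_ideal_def genideal_def by blast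

section \<open>The lattice of a collection of cells\<close>

lemma cell_vector_carrier:
  "cell a \<subseteq> V \<Longrightarrow> cell_vector a \<in> carrier (free_Abelian_group V)"
  by (cases a) (auto simp: cell_vector_def cell_eq split: if_splits
      dest!: keys_diff[THEN subsetD] Poly_Mapping.keys_add[THEN subsetD])

lemma
  assumes "\<forall>C\<in>P. C \<subseteq> interval (1, 1) (m, n)"
  shows lattice_of_exponent_lattice: "exponent_lattice (lattice_of m n P)"
    and cell_vector_in_lattice_of: "cell a \<in> P \<Longrightarrow> cell_vector a \<in> lattice_of m n P"
proof -
  let ?F = "free_Abelian_group (interval (1, 1) (m, n))"
  interpret group ?F by simp
  have "{cell_vector a | a. cell a \<in> P} \<subseteq> carrier ?F"
    using assms cell_vector_carrier by blast
  then have "subgroup (lattice_of m n P) ?F"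
    unfolding lattice_of_def by (rule generate_is_subgroup)
  then interpret S: subgroup "lattice_of m n P" ?F .
  have "x - y \<in> lattice_of m n P" if "x \<in> lattice_of m n P" "y \<in> lattice_of m n P" for x y
  proof -
    have "y \<in> carrier ?F" by (rule subsetD[OF S.subset that(2)])
    then show ?thesis using S.m_closed[OF that(1) S.m_inv_closed[OF that(2)]] by simp
  qed
  then show "exponent_lattice (lattice_of m n P)"
    using S.one_closed by unfold_locales simp_all
  show "cell a \<in> P \<Longrightarrow> cell_vector a \<in> lattice_of m n P"
    unfolding lattice_of_def by (blast intro: generate.incl)
qed

text \<open>The property \<open>Q z\<close> proved by induction over the generation of the lattice asks only for some
  pair \<open>(p, q)\<close> with \<open>z = p - q\<close> and \<open>x\<^sup>w (x\<^sup>p - x\<^sup>q) \<in> I\<^sub>P\<close> for some \<open>w\<close>, so that pairs can simply be added. The given pair \<open>(a, b)\<close> then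
  satisfies \<open>a + q = b + p\<close>, and multiplying \<open>x\<^sup>a - x\<^sup>b\<close> by \<open>x\<^sup>q\<close> gives a multiple of
  \<open>x\<^sup>p - x\<^sup>q\<close>.\<close>

lemma lattice_pair_annihilated:
  fixes P :: "vertex set set"
  assumes P: "\<forall>C\<in>P. C \<subseteq> interval (1, 1) (m, n)"
    and a: "Poly_Mapping.keys a \<subseteq> vertices P" and b: "Poly_Mapping.keys b \<subseteq> vertices P"
    and ab: "int_exp a - int_exp b \<in> lattice_of m n P"
  shows "\<exists>w. Poly_Mapping.keys w \<subseteq> vertices P \<and>
    monomial w * (monomial a - monomial b) \<in> (inner_ideal P :: 'k::field mpoly set)"
proof -
  let ?V = "vertices P" and ?I = "inner_ideal P :: 'k mpoly set"
  note I = vertex_ring_ideal_closed[OF inner_ideal_ideal[where P = P]]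
  define R where "R z p q w \<longleftrightarrow> Poly_Mapping.keys p \<subseteq> ?V \<and> Poly_Mapping.keys q \<subseteq> ?V \<and>
      Poly_Mapping.keys w \<subseteq> ?V \<and> z = int_exp p - int_exp q \<and>
      monomial w * (monomial p - monomial q) \<in> ?I" for z p q w
  define Q where "Q z \<longleftrightarrow> (\<exists>p q w. R z p q w)" for z
  have QI: "Q z" if "R z p q w" for z p q w
    using that unfolding Q_def by blast
  have cellQ: "Q (cell_vector c)" if c: "cell c \<in> P" for c
  proof -
    obtain i j where ij: "c = (i, j)" by fastforce
    let ?p = "Poly_Mapping.single (i, j) (1::nat) + Poly_Mapping.single (i + 1, j + 1) (1::nat)"
    let ?q = "Poly_Mapping.single (i, j + 1) (1::nat) + Poly_Mapping.single (i + 1, j) (1::nat)"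
    have "monomial 0 * (monomial ?p - monomial ?q) \<in> ?I"
      using inner_binomial_in_inner_ideal[OF inner_interval_cell, of i j P] c ij
      unfolding var_binomial by simp
    moreover have "cell_vector c = int_exp ?p - int_exp ?q"
      using int_exp_single by (simp add: ij cell_vector_def)
    moreover have "Poly_Mapping.keys ?p \<subseteq> ?V" "Poly_Mapping.keys ?q \<subseteq> ?V"
      by (rule keys_two_variables; use cell_subset_vertices[OF c] in \<open>simp add: ij cell_eq\<close>)+
    ultimately show ?thesis
      by (intro QI[of _ ?p ?q 0]) (simp add: R_def)
  qed
  have minusQ: "Q (- z)" if "Q z" for z
  proof -
    obtain p q w where "R z p q w"
      using \<open>Q z\<close> unfolding Q_def by blast
    then have pqw: "Poly_Mapping.keys p \<subseteq> ?V" "Poly_Mapping.keys q \<subseteq> ?V"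
      "Poly_Mapping.keys w \<subseteq> ?V" "z = int_exp p - int_exp q"
      "monomial w * (monomial p - monomial q) \<in> ?I"
      unfolding R_def by simp_all
    have "monomial w * (monomial q - monomial p) \<in> ?I"
      using I(5)[OF pqw(5)] by (simp add: right_diff_distrib)
    then show ?thesis
      using pqw by (intro QI[of _ q p w]) (simp add: R_def)
  qed
  have addQ: "Q (z + z')" if "Q z" "Q z'" for z z'
  proof -
    obtain p q w where "R z p q w"
      using \<open>Q z\<close> unfolding Q_def by blast
    then have pqw: "Poly_Mapping.keys p \<subseteq> ?V" "Poly_Mapping.keys q \<subseteq> ?V"
      "Poly_Mapping.keys w \<subseteq> ?V" "z = int_exp p - int_exp q"
      "monomial w * (monomial p - monomial q) \<in> ?I"
      unfolding R_def by simp_all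
    obtain p' q' w' where "R z' p' q' w'"
      using \<open>Q z'\<close> unfolding Q_def by blast
    then have pqw': "Poly_Mapping.keys p' \<subseteq> ?V" "Poly_Mapping.keys q' \<subseteq> ?V"
      "Poly_Mapping.keys w' \<subseteq> ?V" "z' = int_exp p' - int_exp q'"
      "monomial w' * (monomial p' - monomial q') \<in> ?I"
      unfolding R_def by simp_all
    have "monomial (w' + p') * (monomial w * (monomial p - monomial q)) +
        monomial (w + q) * (monomial w' * (monomial p' - monomial q')) \<in> ?I"
      using pqw pqw' by (intro I(3) I(4)[OF pqw(5)] I(4)[OF pqw'(5)] monomial_carrier keys_add_subset)
    also have "monomial (w' + p') * (monomial w * (monomial p - monomial q)) +
        monomial (w + q) * (monomial w' * (monomial p' - monomial q')) =
        monomial (w + w') * (monomial (p + p') - monomial (q + q') :: 'k mpoly)"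
      by (simp add: monomial_add algebra_simps)
    finally have "monomial (w + w') * (monomial (p + p') - monomial (q + q')) \<in> ?I" .
    then show ?thesis
      using pqw pqw' by (intro QI[of _ "p + p'" "q + q'" "w + w'"]) (simp add: R_def keys_add_subset)
  qed
  have "Q z" if "z \<in> lattice_of m n P" for z
    using that unfolding lattice_of_def
  proof (induction rule: generate.induct)
    case one
    have "Q 0"
      using I(2) by (intro QI[of _ 0 0 0]) (simp add: R_def)
    then show ?case by simp
  next
    case (incl h)
    then show ?case using cellQ by blast
  next
    case (inv h)
    then obtain c where c: "h = cell_vector c" "cell c \<in> P" by blast
    then have "h \<in> carrier (free_Abelian_group (interval (1, 1) (m, n)))"
      using cell_vector_carrier P by blast
    then show ?case using minusQ[OF cellQ[OF c(2)]] c(1) by simp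
  next
    case (eng h1 h2)
    then show ?case using addQ by simp
  qed
  then obtain p q w where "R (int_exp a - int_exp b) p q w"
    using ab unfolding Q_def by blast
  then have pqw: "Poly_Mapping.keys p \<subseteq> ?V" "Poly_Mapping.keys q \<subseteq> ?V"
    "Poly_Mapping.keys w \<subseteq> ?V" "int_exp a - int_exp b = int_exp p - int_exp q"
    "monomial w * (monomial p - monomial q) \<in> ?I"
    unfolding R_def by simp_all
  have "int_exp (a + q) = int_exp (b + p)"
    using pqw(4) by (simp add: algebra_simps)
  then have aq: "a + q = b + p" by (simp only: int_exp_inject)
  have "monomial (w + q) * (monomial a - monomial b) =
      monomial w * (monomial (a + q) - monomial (b + q) :: 'k mpoly)"
    by (simp add: monomial_add algebra_simps)
  also have "\<dots> = monomial b * (monomial w * (monomial p - monomial q))"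
    unfolding aq by (simp add: monomial_add algebra_simps)
  also have "\<dots> \<in> ?I"
    using I(4)[OF pqw(5) monomial_carrier[OF b]] .
  finally show ?thesis
    using keys_add_subset[OF pqw(3,2)] by blast
qed

lemma inner_ideal_subset_lattice_ideal:
  assumes P: "\<forall>C\<in>P. C \<subseteq> interval (1, 1) (m, n)"
  shows "inner_ideal P \<subseteq> lattice_ideal (vertices P) (lattice_of m n P)"
proof -
  interpret cring "vertex_ring (vertices P)" by (rule vertex_ring_cring)
  interpret L: exponent_lattice "lattice_of m n P"
    by (rule lattice_of_exponent_lattice[OF P])
  have "var (i, j) * var (k, l) - var (i, l) * var (k, j)
      \<in> lattice_ideal (vertices P) (lattice_of m n P)"
    if ijkl: "inner_interval P (i, j) (k, l)" for i j k l
    unfolding var_binomial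
  proof (rule L.binomial_in_lattice_ideal)
    have "frag_of (i, j) + frag_of (k, l) - frag_of (k, j) - frag_of (i, l) \<in> lattice_of m n P"
      using ijkl L.zero L.add cell_vector_in_lattice_of[OF P] inner_interval_cells[OF ijkl]
      by (intro interval_vector_telescope) (auto simp: inner_interval_def proper_def)
    then show "int_exp (Poly_Mapping.single (i, j) 1 + Poly_Mapping.single (k, l) 1) -
        int_exp (Poly_Mapping.single (i, l) 1 + Poly_Mapping.single (k, j) 1) \<in> lattice_of m n P"
      using int_exp_single by (simp add: algebra_simps)
  qed (use inner_interval_corners[OF ijkl] in \<open>(intro keys_two_variables; simp)+\<close>)
  then show ?thesis
    unfolding inner_ideal_def by (intro genideal_minimal L.lattice_ideal_ideal) auto
qed

section \<open>The lattice ideal as a colon ideal\<close>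

theorem lemma1p1:
  fixes m n :: nat and P :: "vertex set set"
  assumes "finite P"
    and "P \<subseteq> range cell"
    and "\<forall>C \<in> P. C \<subseteq> interval (1, 1) (m, n)"
  shows "\<exists>w. Poly_Mapping.keys w \<subseteq> vertices P \<and>
    (lattice_ideal (vertices P) (lattice_of m n P) :: 'k::field mpoly set) =
      colon_ideal (vertex_ring (vertices P)) (inner_ideal P) (monomial w)"
proof -
  let ?V = "vertices P" and ?L = "lattice_of m n P" and ?I = "inner_ideal P :: 'k mpoly set"
  interpret cring "vertex_ring ?V :: 'k mpoly ring" by (rule vertex_ring_cring)
  interpret L: exponent_lattice ?L
    by (rule lattice_of_exponent_lattice[OF assms(3)])
  have "?V \<subseteq> interval (1, 1) (m, n)" using assms(3) by (auto simp: vertices_def)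
  then have "finite ?V" by (rule finite_subset) (simp add: interval_def)
  then obtain w where w: "Poly_Mapping.keys w \<subseteq> ?V"
    "\<And>a b. Poly_Mapping.keys a \<subseteq> ?V \<Longrightarrow> Poly_Mapping.keys b \<subseteq> ?V \<Longrightarrow>
      int_exp a - int_exp b \<in> ?L \<Longrightarrow> monomial w * (monomial a - monomial b) \<in> ?I"
    using L.uniform_annihilator[where I = ?I, OF inner_ideal_ideal]
      lattice_pair_annihilated[OF assms(3), where 'k = 'k] by blast
  have "lattice_ideal ?V ?L \<subseteq> colon_ideal (vertex_ring ?V) ?I (monomial w)"
  proof -
    have "monomial a - monomial b \<in> colon_ideal (vertex_ring ?V) ?I (monomial w)"
      if "Poly_Mapping.keys a \<subseteq> ?V" "Poly_Mapping.keys b \<subseteq> ?V" "int_exp a - int_exp b \<in> ?L" for a b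
      using w(2)[OF that] L.binomial_in_lattice_ideal[OF that]
        vertex_ring_ideal_closed(1)[OF L.lattice_ideal_ideal]
      by (auto simp: colon_ideal_def)
    then show ?thesis
      unfolding lattice_ideal_def
      by (intro genideal_minimal colon_ideal_ideal inner_ideal_ideal monomial_carrier w(1)) auto
  qed
  moreover have "colon_ideal (vertex_ring ?V) ?I (monomial w) \<subseteq> lattice_ideal ?V ?L"
    using L.lattice_ideal_saturated inner_ideal_subset_lattice_ideal[OF assms(3)]
    by (auto simp: colon_ideal_def)
  ultimately show ?thesis using w(1) by blast
qed

end
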